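(* Let $f\colon\mathbb{N}^2\to\mathbb{N}$ be any max-dominating pairing function. Define $\phi_f$ on $\mathbb{N}$ by $\phi_f(0)=o$ and, for each pair $(x,y)\in\mathbb{N}^2$, $\phi_f(f(x,y)+1)=\tau(\phi_f(x),\phi_f(y))$. Then $\phi_f$ is an enumeration of the set $T$ of full binary trees, i.e. a bijection from $\mathbb{N}$ onto $T$.
   Context: $\mathbb{N}$ denotes the set of non-negative integers. A pairing function for $\mathbb{N}$ is a bijection $\mathbb{N}^2\to\mathbb{N}$; it is max-dominating if $\max(x,y)\le f(x,y)$ for all $(x,y)\in\mathbb{N}^2$. $o$ denotes the binary tree with a single vertex, and $\tau(a,b)$ denotes the binary tree whose root has left subtree $a$ and right subtree $b$. The set $T$ of full binary trees is the smallest set containing $o$ and closed under $\tau$. (Since $f$ is a bijection and $x,y\le f(x,y)<f(x,y)+1$, the recursion defining $\phi_f$ determines a unique function on $\mathbb{N}$.) *)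

theory Defs
  imports Main
begin

definition pairing_function :: "(nat \<times> nat \<Rightarrow> nat) \<Rightarrow> bool" where
  "pairing_function f \<longleftrightarrow> bij f"

definition max_dominating :: "(nat \<times> nat \<Rightarrow> nat) \<Rightarrow> bool" where
  "max_dominating f \<longleftrightarrow> (\<forall>x y. max x y \<le> f (x, y))"

(* The set T is the universe of this type. Leaf is the one-vertex tree o (not the empty tree),
   and Node a b is tau(a, b). *)
datatype full_binary_tree = Leaf | Node full_binary_tree full_binary_tree

definition tree_recursion :: "(nat \<times> nat \<Rightarrow> nat) \<Rightarrow> (nat \<Rightarrow> full_binary_tree) \<Rightarrow> bool" where
  "tree_recursion f \<phi> \<longleftrightarrow>
     \<phi> 0 = Leaf \<and> (\<forall>x y. \<phi> (f (x, y) + 1) = Node (\<phi> x) (\<phi> y))"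

(* Meaningful only for max-dominating pairing functions f; see the two lemmas below. *)
definition tree_enum :: "(nat \<times> nat \<Rightarrow> nat) \<Rightarrow> nat \<Rightarrow> full_binary_tree" where
  "tree_enum f = (THE \<phi>. tree_recursion f \<phi>)"

lemma ex1_tree_recursion:
  assumes "pairing_function f" and "max_dominating f"
  shows "\<exists>!\<phi>. tree_recursion f \<phi>"
proof -
  have b: "bij f" and le: "\<And>x y. x \<le> f (x, y) \<and> y \<le> f (x, y)"
    using assms by (auto simp: pairing_function_def max_dominating_def)
  define H :: "(nat \<Rightarrow> full_binary_tree) \<Rightarrow> nat \<Rightarrow> full_binary_tree" where
    "H \<phi> n = (case n of 0 \<Rightarrow> Leaf
       | Suc m \<Rightarrow> Node (\<phi> (fst (inv f m))) (\<phi> (snd (inv f m))))" for \<phi> n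
  define \<phi> where "\<phi> = wfrec less_than H"
  have eq: "\<phi> n = H (cut \<phi> less_than n) n" for n
    unfolding \<phi>_def by (rule wfrec) simp
  have "tree_recursion f \<phi>"
    unfolding tree_recursion_def
  proof (intro conjI allI)
    show "\<phi> 0 = Leaf"
      by (subst eq) (simp add: H_def)
    show "\<phi> (f (x, y) + 1) = Node (\<phi> x) (\<phi> y)" for x y
      using le[of x y] bij_is_inj[OF b] by (subst eq) (simp add: H_def cut_def inv_f_f)
  qed
  moreover have "\<psi> = \<chi>" if \<psi>: "tree_recursion f \<psi>" and \<chi>: "tree_recursion f \<chi>" for \<psi> \<chi>
  proof
    show "\<psi> n = \<chi> n" for n
    proof (induction n rule: less_induct)
      case (less n)
      show ?case
      proof (cases n)
        case 0
        then show ?thesis using \<psi> \<chi> by (simp add: tree_recursion_def)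
      next
        case (Suc m)
        obtain x y where m: "f (x, y) = m"
          using bij_is_surj[OF b] by (metis surj_def surj_pair)
        have "\<psi> x = \<chi> x" "\<psi> y = \<chi> y"
          using less.IH le[of x y] m Suc by auto
        moreover have "n = f (x, y) + 1" using m Suc by simp
        ultimately show ?thesis using \<psi> \<chi> by (simp only: tree_recursion_def)
      qed
    qed
  qed
  ultimately show ?thesis by blast
qed

lemma tree_recursion_tree_enum:
  assumes "pairing_function f" and "max_dominating f"
  shows "tree_recursion f (tree_enum f)"
  unfolding tree_enum_def by (rule theI'[OF ex1_tree_recursion[OF assms]])

end

theory Submission
  imports Defs
begin

text \<open>Bijectivity says that every tree has exactly one code, which is shown by structural
  induction on trees. Since \<open>f\<close> is onto, every positive number is
  \<open>f (x, y) + 1\<close> for some \<open>x\<close>, \<open>y\<close>. Hence 0 is the only code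
  of \<open>Leaf\<close>, and the codes of \<open>Node a b\<close> are the numbers
  \<open>f (x, y) + 1\<close> with \<open>x\<close> a code of \<open>a\<close> and \<open>y\<close>
  a code of \<open>b\<close>; by induction these are unique. Injectivity and max-dominance of
  \<open>f\<close> enter through \<open>tree_recursion_tree_enum\<close>, which gives the recursion
  equations.\<close>

theorem theorem8:
  fixes f :: "nat \<times> nat \<Rightarrow> nat"
  assumes "pairing_function f" and "max_dominating f"
  shows "bij_betw (tree_enum f) (UNIV :: nat set) (UNIV :: full_binary_tree set)"
proof -
  let ?\<phi> = "tree_enum f"
  have zero: "?\<phi> 0 = Leaf" and step: "?\<phi> (Suc (f (x, y))) = Node (?\<phi> x) (?\<phi> y)" for x y
    using tree_recursion_tree_enum[OF assms] by (auto simp: tree_recursion_def)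
  have "surj f"
    using assms(1) by (simp add: pairing_function_def bij_is_surj)
  then have cases: "n = 0 \<or> (\<exists>x y. n = Suc (f (x, y)))" for n
    by (metis not0_implies_Suc surjD surj_pair)
  \<comment> \<open>Existence for all \<open>t\<close> is surjectivity, uniqueness is injectivity;
    one induction yields both.\<close>
  have "\<exists>!n. ?\<phi> n = t" for t
  proof (induction t)
    case Leaf
    have "n = 0" if "?\<phi> n = Leaf" for n
      using cases[of n] that by (auto simp: step)
    with zero show ?case
      by blast
  next
    case (Node a b)
    then obtain x y where x: "?\<phi> x = a" "\<And>x'. ?\<phi> x' = a \<Longrightarrow> x' = x"
      and y: "?\<phi> y = b" "\<And>y'. ?\<phi> y' = b \<Longrightarrow> y' = y"
      by blast
    show ?case
    proof (rule ex1I)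
      show "?\<phi> (Suc (f (x, y))) = Node a b"
        by (simp add: step x(1) y(1))
    next
      fix n
      assume n: "?\<phi> n = Node a b"
      with cases[of n] zero obtain x' y' where n': "n = Suc (f (x', y'))"
        by auto
      \<comment> \<open>Injectivity of \<open>Node\<close> makes \<open>x'\<close> and
        \<open>y'\<close> codes of the two subtrees, so the induction hypotheses identify them with
        \<open>x\<close> and \<open>y\<close>.\<close>
      with n have "?\<phi> x' = a" "?\<phi> y' = b"
        by (simp_all add: step)
      from x(2)[OF this(1)] y(2)[OF this(2)] n' show "n = Suc (f (x, y))"
        by simp
    qed
  qed
  then show ?thesis
    by (simp add: bij_iff)
qed

end
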